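(* Let $\mathcal{C}$ be a set of shape constraints in normal form in which every shape name occurring in $\mathcal{C}$ is the head of a constraint of $\mathcal{C}$, and let $s$ be a shape name defined in $\mathcal{C}$. For every data graph $\mathcal{G}$ compatible with $\mathcal{C}$ and every node $c\in\Delta^{\mathcal{G}}$: $\mathcal{G}$ validates $(\mathcal{C},s(c))$ under the well-founded semantics (i.e. $s(c)\in WF_{\mathcal{G},\mathcal{C}}$) if and only if $\mathcal{G},c\models tr^+_{\emptyset,\mathcal{C}}(s)$.
   Context: Fix countably infinite, pairwise disjoint sets $N_C$ (concept names), $N_R$ (role names), $N_I$ (individuals), $N_S$ (shape names). Roles are $p,p^-$ for $p\in N_R$, $(p^-)^-=p$. A data graph $\mathcal{G}$ is a (finite or countably infinite) set of atoms $A(a)$, $p(a,a')$; $\Delta^{\mathcal{G}}$ its individuals, $A^{\mathcal{G}}=\{a\mid A(a)\in\mathcal{G}\}$, $p^{\mathcal{G}}=\{(a,a')\mid p(a,a')\in\mathcal{G}\}$, $(p^-)^{\mathcal{G}}$ the inverse relation. $\mathcal{G}$ is compatible with $\mathcal{C}$ if every individual occurring in $\mathcal{C}$ occurs in $\mathcal{G}$. A set $\mathcal{C}$ of shape constraints is in normal form if each constraint has one of the forms $s\gets A$, $s\gets a$, $s\gets\neg s'$, $s\gets\exists r.s'$, $s\gets\forall r.s'$, $s\gets s'\land s''$, $s\gets s'\lor s''$ ($A\in N_C$, $a\in N_I$, $r$ a role, $s,s',s''\in N_S$), with at most one constraint per head $s$; its body is $\mathcal{C}(s)$. Well-founded semantics: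 a shape assignment $S$ is a set of literals $s(a),\neg s(a)$ with no contradictory pair; $\neg.U=\{\neg s(a)\mid s(a)\in U\}$. Define $\lfloor\cdot\rfloor^{\mathcal{G}}_S$, $\lceil\cdot\rceil^{\mathcal{G}}_S$: $\lfloor s\rfloor=\{a\mid s(a)\in S\}$, $\lceil s\rceil=\{a\in\Delta^{\mathcal{G}}\mid\neg s(a)\notin S\}$, $\lfloor\neg s\rfloor=\{a\mid\neg s(a)\in S\}$, $\lceil\neg s\rceil=\{a\in\Delta^{\mathcal{G}}\mid s(a)\notin S\}$, and for $[\cdot]$ either one: $[a]=\{a\}$, $[A]=A^{\mathcal{G}}$, $[\varphi\lor\varphi']=[\varphi]\cup[\varphi']$, $[\varphi\land\varphi']=[\varphi]\cap[\varphi']$, $[\forall r.\varphi]=\{a\in\Delta^{\mathcal{G}}\mid\forall a'((a,a')\in r^{\mathcal{G}}\Rightarrow a'\in[\varphi])\}$, $[\exists r.\varphi]=\{a\in\Delta^{\mathcal{G}}\mid\exists a'((a,a')\in r^{\mathcal{G}}, a'\in[\varphi])\}$. $T_{\mathcal{G},\mathcal{C}}(S)=\{s(a)\mid s\gets\varphi\in\mathcal{C},a\in\lfloor\varphi\rfloor^{\mathcal{G}}_S\}$; $U$ (a set of shape atoms) is unfounded w.r.t. $S,\mathcal{G},\mathcal{C}$ if $a\notin\lceil\mathcal{C}(s)\rceil^{\mathcal{G}}_{S\cup\neg.U}$ for all $s(a)\in U$; $U_{\mathcal{G},\mathcal{C}}(S)$ is the greatest unfounded set; $W_{\mathcal{G},\mathcal{C}}(S)=T_{\mathcal{G},\mathcal{C}}(S)\cup\neg.U_{\mathcal{G},\mathcal{C}}(S)$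 (monotone), and $WF_{\mathcal{G},\mathcal{C}}$ is its least fixed point. Full hybrid $\mu$-calculus: with a set $N_V$ of variables, $\Phi::=A\mid\neg A\mid a\mid\neg a\mid X\mid\Phi\land\Phi\mid\Phi\lor\Phi\mid[r]\Phi\mid\langle r\rangle\Phi\mid\mu X.\Phi\mid\nu X.\Phi$. For a graph $\mathcal{G}$ and valuation $V:N_V\to 2^{\Delta^{\mathcal{G}}}$: $\|A\|=A^{\mathcal{G}}$, $\|\neg A\|=\Delta^{\mathcal{G}}\setminus A^{\mathcal{G}}$, $\|a\|=\{a\}$, $\|\neg a\|=\Delta^{\mathcal{G}}\setminus\{a\}$, $\|X\|=V(X)$, $\land,\lor$ as $\cap,\cup$, $\|[r]\Phi\|=\{e\in\Delta^{\mathcal{G}}\mid\forall e'((e,e')\in r^{\mathcal{G}}\Rightarrow e'\in\|\Phi\|)\}$, $\|\langle r\rangle\Phi\|=\{e\in\Delta^{\mathcal{G}}\mid\exists e'((e,e')\in r^{\mathcal{G}},e'\in\|\Phi\|)\}$, $\|\mu X.\Phi\|_V=\bigcap\{U\subseteq\Delta^{\mathcal{G}}\mid\|\Phi\|_{V[X\mapsto U]}\subseteq U\}$, $\|\nu X.\Phi\|_V=\bigcup\{U\subseteq\Delta^{\mathcal{G}}\mid U\subseteq\|\Phi\|_{V[X\mapsto U]}\}$. For closed $\Phi$, $\mathcal{G},c\models\Phi$ iff $c\in\|\Phi\|^{\mathcal{G}}$. Translation: use variables $X_s$ and $X_{\bar s}$ for each shape name $s$; $S$ ranges over finite sets of symbols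 $s$ and $\bar s$, and $pos(S)=S\setminus\{\bar s\mid \bar s\in S\}$. Define mutually recursively: $tr^+_{S,\mathcal{C}}(s\land s')=tr^+_{S,\mathcal{C}}(s)\land tr^+_{S,\mathcal{C}}(s')$, $tr^-_{S,\mathcal{C}}(s\land s')=tr^-_{S,\mathcal{C}}(s)\lor tr^-_{S,\mathcal{C}}(s')$; $tr^+_{S,\mathcal{C}}(s\lor s')=tr^+_{S,\mathcal{C}}(s)\lor tr^+_{S,\mathcal{C}}(s')$, $tr^-_{S,\mathcal{C}}(s\lor s')=tr^-_{S,\mathcal{C}}(s)\land tr^-_{S,\mathcal{C}}(s')$; $tr^+_{S,\mathcal{C}}(\exists r.s)=\langle r\rangle tr^+_{S,\mathcal{C}}(s)$, $tr^-_{S,\mathcal{C}}(\exists r.s)=[r]tr^-_{S,\mathcal{C}}(s)$; $tr^+_{S,\mathcal{C}}(\forall r.s)=[r]tr^+_{S,\mathcal{C}}(s)$, $tr^-_{S,\mathcal{C}}(\forall r.s)=\langle r\rangle tr^-_{S,\mathcal{C}}(s)$; $tr^+(A)=A$, $tr^-(A)=\neg A$, $tr^+(a)=a$, $tr^-(a)=\neg a$; $tr^+_{S,\mathcal{C}}(\neg s)=tr^-_{S,\mathcal{C}}(s)$, $tr^-_{S,\mathcal{C}}(\neg s)=tr^+_{pos(S),\mathcal{C}}(s)$; $tr^+_{S,\mathcal{C}}(s)=X_s$ if $s\in S$ and $\mu X_s.tr^+_{S\cup\{s\},\mathcal{C}}(\mathcal{C}(s))$ otherwise; $tr^-_{S,\mathcal{C}}(s)=X_{\bar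 s}$ if $\bar s\in S$ and $\nu X_{\bar s}.tr^-_{S\cup\{\bar s\},\mathcal{C}}(\mathcal{C}(s))$ otherwise (for a shape name $s$). *)

theory Defs
  imports Main
begin

section \<open>Names, roles and data graphs\<close>

text \<open>The four sets of names are countably infinite types; they are disjoint by typing.\<close>

datatype concept_name = ConceptName nat
datatype role_name = RoleName nat
datatype individual = Individual nat
datatype shape_name = ShapeName nat

datatype role = Role role_name | Inv role_name

datatype graph_atom =
    ConceptAtom concept_name individual
  | RoleAtom role_name individual individual

text \<open>Since there are only countably many atoms, every set of atoms is finite or countably infinite.\<close>

type_synonym data_graph = "graph_atom set"

primrec atom_individuals :: "graph_atom \<Rightarrow> individual set" where
  "atom_individuals (ConceptAtom A a) = {a}"
| "atom_individuals (RoleAtom p a b) = {a, b}"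

definition nodes :: "data_graph \<Rightarrow> individual set" where
  "nodes G = (\<Union>x\<in>G. atom_individuals x)"

definition concept_ext :: "data_graph \<Rightarrow> concept_name \<Rightarrow> individual set" where
  "concept_ext G A = {a. ConceptAtom A a \<in> G}"

primrec role_ext :: "data_graph \<Rightarrow> role \<Rightarrow> (individual \<times> individual) set" where
  "role_ext G (Role p) = {(a, b). RoleAtom p a b \<in> G}"
| "role_ext G (Inv p) = {(a, b). RoleAtom p a b \<in> G}\<inverse>"

section \<open>Shape constraints\<close>

datatype shape_expr =
    Shape shape_name
  | Concept concept_name
  | Nominal individual
  | NegShape shape_name
  | And shape_expr shape_expr
  | Or shape_expr shape_expr
  | Exists role shape_expr
  | Forall role shape_expr

primrec expr_shapes :: "shape_expr \<Rightarrow> shape_name set" where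
  "expr_shapes (Shape s) = {s}"
| "expr_shapes (Concept A) = {}"
| "expr_shapes (Nominal a) = {}"
| "expr_shapes (NegShape s) = {s}"
| "expr_shapes (And \<phi> \<psi>) = expr_shapes \<phi> \<union> expr_shapes \<psi>"
| "expr_shapes (Or \<phi> \<psi>) = expr_shapes \<phi> \<union> expr_shapes \<psi>"
| "expr_shapes (Exists r \<phi>) = expr_shapes \<phi>"
| "expr_shapes (Forall r \<phi>) = expr_shapes \<phi>"

primrec expr_individuals :: "shape_expr \<Rightarrow> individual set" where
  "expr_individuals (Shape s) = {}"
| "expr_individuals (Concept A) = {}"
| "expr_individuals (Nominal a) = {a}"
| "expr_individuals (NegShape s) = {}"
| "expr_individuals (And \<phi> \<psi>) = expr_individuals \<phi> \<union> expr_individuals \<psi>"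
| "expr_individuals (Or \<phi> \<psi>) = expr_individuals \<phi> \<union> expr_individuals \<psi>"
| "expr_individuals (Exists r \<phi>) = expr_individuals \<phi>"
| "expr_individuals (Forall r \<phi>) = expr_individuals \<phi>"

text \<open>A pair \<open>(s, \<phi>)\<close> is the constraint with head \<open>s\<close> and body \<open>\<phi>\<close>.\<close>

type_synonym shape_constraint = "shape_name \<times> shape_expr"

definition heads :: "shape_constraint set \<Rightarrow> shape_name set" where
  "heads C = fst ` C"

text \<open>Only meaningful for a head of \<open>C\<close> that has exactly one constraint.\<close>

definition body :: "shape_constraint set \<Rightarrow> shape_name \<Rightarrow> shape_expr" where
  "body C s = (THE \<phi>. (s, \<phi>) \<in> C)"

definition shape_names :: "shape_constraint set \<Rightarrow> shape_name set" where
  "shape_names C = (\<Union>(s, \<phi>)\<in>C. insert s (expr_shapes \<phi>))"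

definition constraint_individuals :: "shape_constraint set \<Rightarrow> individual set" where
  "constraint_individuals C = (\<Union>(s, \<phi>)\<in>C. expr_individuals \<phi>)"

definition compatible :: "data_graph \<Rightarrow> shape_constraint set \<Rightarrow> bool" where
  "compatible G C \<longleftrightarrow> constraint_individuals C \<subseteq> nodes G"

inductive normal_body :: "shape_expr \<Rightarrow> bool" where
  "normal_body (Concept A)"
| "normal_body (Nominal a)"
| "normal_body (NegShape s)"
| "normal_body (Exists r (Shape s))"
| "normal_body (Forall r (Shape s))"
| "normal_body (And (Shape s) (Shape s'))"
| "normal_body (Or (Shape s) (Shape s'))"

definition normal_form :: "shape_constraint set \<Rightarrow> bool" where
  "normal_form C \<longleftrightarrow>
     (\<forall>(s, \<phi>)\<in>C. normal_body \<phi>) \<and>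
     (\<forall>s \<phi> \<psi>. (s, \<phi>) \<in> C \<longrightarrow> (s, \<psi>) \<in> C \<longrightarrow> \<phi> = \<psi>)"

definition dependency :: "shape_constraint set \<Rightarrow> (shape_name \<times> shape_name) set" where
  "dependency C = {(s, s'). \<exists>\<phi>. (s, \<phi>) \<in> C \<and> s' \<in> expr_shapes \<phi>}"

section \<open>Well-founded semantics\<close>

text \<open>A pair \<open>(s, a)\<close> is the shape atom \<open>s(a)\<close>.\<close>

type_synonym shape_atom = "shape_name \<times> individual"

datatype literal = Lit shape_atom | NegLit shape_atom

primrec lower :: "data_graph \<Rightarrow> literal set \<Rightarrow> shape_expr \<Rightarrow> individual set" where
  "lower G S (Shape s) = {a. Lit (s, a) \<in> S}"
| "lower G S (Concept A) = concept_ext G A"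
| "lower G S (Nominal a) = {a}"
| "lower G S (NegShape s) = {a. NegLit (s, a) \<in> S}"
| "lower G S (And \<phi> \<psi>) = lower G S \<phi> \<inter> lower G S \<psi>"
| "lower G S (Or \<phi> \<psi>) = lower G S \<phi> \<union> lower G S \<psi>"
| "lower G S (Exists r \<phi>) = {a \<in> nodes G. \<exists>b. (a, b) \<in> role_ext G r \<and> b \<in> lower G S \<phi>}"
| "lower G S (Forall r \<phi>) = {a \<in> nodes G. \<forall>b. (a, b) \<in> role_ext G r \<longrightarrow> b \<in> lower G S \<phi>}"

primrec upper :: "data_graph \<Rightarrow> literal set \<Rightarrow> shape_expr \<Rightarrow> individual set" where
  "upper G S (Shape s) = {a \<in> nodes G. NegLit (s, a) \<notin> S}"
| "upper G S (Concept A) = concept_ext G A"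
| "upper G S (Nominal a) = {a}"
| "upper G S (NegShape s) = {a \<in> nodes G. Lit (s, a) \<notin> S}"
| "upper G S (And \<phi> \<psi>) = upper G S \<phi> \<inter> upper G S \<psi>"
| "upper G S (Or \<phi> \<psi>) = upper G S \<phi> \<union> upper G S \<psi>"
| "upper G S (Exists r \<phi>) = {a \<in> nodes G. \<exists>b. (a, b) \<in> role_ext G r \<and> b \<in> upper G S \<phi>}"
| "upper G S (Forall r \<phi>) = {a \<in> nodes G. \<forall>b. (a, b) \<in> role_ext G r \<longrightarrow> b \<in> upper G S \<phi>}"

definition T_op :: "data_graph \<Rightarrow> shape_constraint set \<Rightarrow> literal set \<Rightarrow> literal set" where
  "T_op G C S = {Lit (s, a) | s a \<phi>. (s, \<phi>) \<in> C \<and> a \<in> lower G S \<phi>}"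

text \<open>
  Unfounded sets consist of atoms \<open>s(a)\<close> with \<open>s\<close> a head of \<open>C\<close> (otherwise \<open>s\<close> has no body) and
  \<open>a\<close> a node of \<open>G\<close>. Without the restriction to nodes, an individual outside the graph could
  acquire contradictory literals, because \<open>lower\<close> of a negated shape name is not cut down to nodes
  while \<open>upper\<close> is.
\<close>

definition unfounded ::
    "data_graph \<Rightarrow> shape_constraint set \<Rightarrow> literal set \<Rightarrow> shape_atom set \<Rightarrow> bool" where
  "unfounded G C S U \<longleftrightarrow>
     U \<subseteq> heads C \<times> nodes G \<and>
     (\<forall>s a. (s, a) \<in> U \<longrightarrow> a \<notin> upper G (S \<union> NegLit ` U) (body C s))"

definition greatest_unfounded ::
    "data_graph \<Rightarrow> shape_constraint set \<Rightarrow> literal set \<Rightarrow> shape_atom set" where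
  "greatest_unfounded G C S = \<Union>{U. unfounded G C S U}"

definition W_op :: "data_graph \<Rightarrow> shape_constraint set \<Rightarrow> literal set \<Rightarrow> literal set" where
  "W_op G C S = T_op G C S \<union> NegLit ` greatest_unfounded G C S"

definition WF :: "data_graph \<Rightarrow> shape_constraint set \<Rightarrow> literal set" where
  "WF G C = lfp (W_op G C)"

definition validates_wf ::
    "data_graph \<Rightarrow> shape_constraint set \<Rightarrow> shape_name \<Rightarrow> individual \<Rightarrow> bool" where
  "validates_wf G C s c \<longleftrightarrow> Lit (s, c) \<in> WF G C"

lemma lower_mono: "S \<subseteq> S' \<Longrightarrow> lower G S \<phi> \<subseteq> lower G S' \<phi>"
  by (induction \<phi>) auto

lemma upper_antimono: "S \<subseteq> S' \<Longrightarrow> upper G S' \<phi> \<subseteq> upper G S \<phi>"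
  by (induction \<phi>) auto

lemma unfounded_greatest_unfounded: "unfounded G C S (greatest_unfounded G C S)"
proof -
  let ?U = "greatest_unfounded G C S"
  have "?U \<subseteq> heads C \<times> nodes G"
    unfolding greatest_unfounded_def unfounded_def by blast
  moreover have "a \<notin> upper G (S \<union> NegLit ` ?U) (body C s)" if sa: "(s, a) \<in> ?U" for s a
  proof -
    obtain U where U: "unfounded G C S U" and saU: "(s, a) \<in> U"
      using sa unfolding greatest_unfounded_def by blast
    have "S \<union> NegLit ` U \<subseteq> S \<union> NegLit ` ?U"
      using U unfolding greatest_unfounded_def by blast
    moreover have "a \<notin> upper G (S \<union> NegLit ` U) (body C s)"
      using U saU unfolding unfounded_def by blast
    ultimately show ?thesis
      using upper_antimono by blast
  qed
  ultimately show ?thesis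
    unfolding unfounded_def by blast
qed

lemma unfounded_mono:
  assumes S: "S \<subseteq> S'" and U: "unfounded G C S U"
  shows "unfounded G C S' U"
proof -
  have "S \<union> NegLit ` U \<subseteq> S' \<union> NegLit ` U"
    using S by blast
  then have upper: "upper G (S' \<union> NegLit ` U) \<phi> \<subseteq> upper G (S \<union> NegLit ` U) \<phi>" for \<phi>
    by (rule upper_antimono)
  have "a \<notin> upper G (S' \<union> NegLit ` U) (body C s)" if "(s, a) \<in> U" for s a
    using U that subsetD[OF upper, of a "body C s"] unfolding unfounded_def by blast
  moreover have "U \<subseteq> heads C \<times> nodes G"
    using U unfolding unfounded_def by (rule conjunct1)
  ultimately show ?thesis
    unfolding unfounded_def by blast
qed

lemma mono_W_op: "mono (W_op G C)"
proof (rule monoI)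
  fix S S' :: "literal set"
  assume S: "S \<subseteq> S'"
  have "greatest_unfounded G C S \<subseteq> greatest_unfounded G C S'"
    unfolding greatest_unfounded_def by (rule Union_mono) (use unfounded_mono[OF S] in blast)
  moreover have "T_op G C S \<subseteq> T_op G C S'"
    using lower_mono[OF S] unfolding T_op_def by blast
  ultimately show "W_op G C S \<subseteq> W_op G C S'"
    unfolding W_op_def by blast
qed

section \<open>Full hybrid mu-calculus\<close>

datatype 'v formula =
    FConcept concept_name
  | FNegConcept concept_name
  | FNominal individual
  | FNegNominal individual
  | FVar 'v
  | FAnd "'v formula" "'v formula"
  | FOr "'v formula" "'v formula"
  | Box role "'v formula"
  | Dia role "'v formula"
  | Mu 'v "'v formula"
  | Nu 'v "'v formula"

primrec sem :: "data_graph \<Rightarrow> 'v formula \<Rightarrow> ('v \<Rightarrow> individual set) \<Rightarrow> individual set" where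
  "sem G (FConcept A) V = concept_ext G A"
| "sem G (FNegConcept A) V = nodes G - concept_ext G A"
| "sem G (FNominal a) V = {a}"
| "sem G (FNegNominal a) V = nodes G - {a}"
| "sem G (FVar X) V = V X"
| "sem G (FAnd \<Phi> \<Psi>) V = sem G \<Phi> V \<inter> sem G \<Psi> V"
| "sem G (FOr \<Phi> \<Psi>) V = sem G \<Phi> V \<union> sem G \<Psi> V"
| "sem G (Box r \<Phi>) V = {e \<in> nodes G. \<forall>e'. (e, e') \<in> role_ext G r \<longrightarrow> e' \<in> sem G \<Phi> V}"
| "sem G (Dia r \<Phi>) V = {e \<in> nodes G. \<exists>e'. (e, e') \<in> role_ext G r \<and> e' \<in> sem G \<Phi> V}"
| "sem G (Mu X \<Phi>) V = \<Inter>{U. U \<subseteq> nodes G \<and> sem G \<Phi> (V(X := U)) \<subseteq> U}"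
| "sem G (Nu X \<Phi>) V = \<Union>{U. U \<subseteq> nodes G \<and> U \<subseteq> sem G \<Phi> (V(X := U))}"

primrec free_vars :: "'v formula \<Rightarrow> 'v set" where
  "free_vars (FConcept A) = {}"
| "free_vars (FNegConcept A) = {}"
| "free_vars (FNominal a) = {}"
| "free_vars (FNegNominal a) = {}"
| "free_vars (FVar X) = {X}"
| "free_vars (FAnd \<Phi> \<Psi>) = free_vars \<Phi> \<union> free_vars \<Psi>"
| "free_vars (FOr \<Phi> \<Psi>) = free_vars \<Phi> \<union> free_vars \<Psi>"
| "free_vars (Box r \<Phi>) = free_vars \<Phi>"
| "free_vars (Dia r \<Phi>) = free_vars \<Phi>"
| "free_vars (Mu X \<Phi>) = free_vars \<Phi> - {X}"
| "free_vars (Nu X \<Phi>) = free_vars \<Phi> - {X}"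

lemma sem_cong: "(\<And>X. X \<in> free_vars \<Phi> \<Longrightarrow> V X = V' X) \<Longrightarrow> sem G \<Phi> V = sem G \<Phi> V'"
proof (induction \<Phi> arbitrary: V V')
  case (Mu X \<Phi>)
  then have "sem G \<Phi> (V(X := U)) = sem G \<Phi> (V'(X := U))" for U
    by (intro Mu.IH) auto
  then show ?case by simp
next
  case (Nu X \<Phi>)
  then have "sem G \<Phi> (V(X := U)) = sem G \<Phi> (V'(X := U))" for U
    by (intro Nu.IH) auto
  then show ?case by simp
next
  case (FAnd \<Phi> \<Psi>)
  from FAnd.IH[of V V'] FAnd.prems show ?case by auto
next
  case (FOr \<Phi> \<Psi>)
  from FOr.IH[of V V'] FOr.prems show ?case by auto
next
  case (Box r \<Phi>)
  from Box.IH[of V V'] Box.prems show ?case by auto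
next
  case (Dia r \<Phi>)
  from Dia.IH[of V V'] Dia.prems show ?case by auto
qed auto

text \<open>
  Intended for closed formulas only, for which the choice of the valuation is irrelevant by
  \<open>sem_cong\<close>.
\<close>

definition models :: "data_graph \<Rightarrow> individual \<Rightarrow> 'v formula \<Rightarrow> bool" where
  "models G c \<Phi> \<longleftrightarrow> c \<in> sem G \<Phi> (\<lambda>_. {})"

section \<open>Translation of shape constraints\<close>

text \<open>
  \<open>Pos s\<close> is the symbol \<open>s\<close> and \<open>Bar s\<close> its barred copy. The symbols also serve as the variables of
  the translated formulas, so the variable indexed by a symbol \<open>x\<close> is \<open>FVar x\<close>.
\<close>

datatype symbol = Pos shape_name | Bar shape_name

definition pos_part :: "symbol set \<Rightarrow> symbol set" where
  "pos_part S = S - range Bar"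

text \<open>
  The recursion terminates if the starting expression depends on only finitely many shape names
  (lemma \<open>tr_dom\<close> below). If infinitely many shape names are reachable, it unfolds forever and there
  is no formula to speak of; hence the functions are partial.
\<close>

function (domintros)
  tr_pos :: "shape_constraint set \<Rightarrow> symbol set \<Rightarrow> shape_expr \<Rightarrow> symbol formula" and
  tr_neg :: "shape_constraint set \<Rightarrow> symbol set \<Rightarrow> shape_expr \<Rightarrow> symbol formula"
where
  "tr_pos C S (And \<phi> \<psi>) = FAnd (tr_pos C S \<phi>) (tr_pos C S \<psi>)"
| "tr_pos C S (Or \<phi> \<psi>) = FOr (tr_pos C S \<phi>) (tr_pos C S \<psi>)"
| "tr_pos C S (Exists r \<phi>) = Dia r (tr_pos C S \<phi>)"
| "tr_pos C S (Forall r \<phi>) = Box r (tr_pos C S \<phi>)"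
| "tr_pos C S (Concept A) = FConcept A"
| "tr_pos C S (Nominal a) = FNominal a"
| "tr_pos C S (NegShape s) = tr_neg C S (Shape s)"
| "tr_pos C S (Shape s) =
     (if Pos s \<in> S then FVar (Pos s)
      else Mu (Pos s) (tr_pos C (S \<union> {Pos s}) (body C s)))"
| "tr_neg C S (And \<phi> \<psi>) = FOr (tr_neg C S \<phi>) (tr_neg C S \<psi>)"
| "tr_neg C S (Or \<phi> \<psi>) = FAnd (tr_neg C S \<phi>) (tr_neg C S \<psi>)"
| "tr_neg C S (Exists r \<phi>) = Box r (tr_neg C S \<phi>)"
| "tr_neg C S (Forall r \<phi>) = Dia r (tr_neg C S \<phi>)"
| "tr_neg C S (Concept A) = FNegConcept A"
| "tr_neg C S (Nominal a) = FNegNominal a"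
| "tr_neg C S (NegShape s) = tr_pos C (pos_part S) (Shape s)"
| "tr_neg C S (Shape s) =
     (if Bar s \<in> S then FVar (Bar s)
      else Nu (Bar s) (tr_neg C (S \<union> {Bar s}) (body C s)))"
  by pat_completeness auto

lemma body_shapes_dependency:
  assumes "normal_form C" and "s \<in> heads C" and "s' \<in> expr_shapes (body C s)"
  shows "(s, s') \<in> dependency C"
proof -
  obtain \<phi> where \<phi>: "(s, \<phi>) \<in> C"
    using assms(2) by (auto simp: heads_def)
  then have "body C s = \<phi>"
    unfolding body_def using assms(1) by (auto simp: normal_form_def)
  then show ?thesis
    using \<phi> assms(3) by (auto simp: dependency_def)
qed

lemma tr_dom_closed:
  assumes fin: "finite D" and cl: "\<And>s. s \<in> D \<Longrightarrow> expr_shapes (body C s) \<subseteq> D"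
  shows "expr_shapes \<phi> \<subseteq> D \<Longrightarrow>
    tr_pos_tr_neg_dom (Inl (C, S, \<phi>)) \<and> tr_pos_tr_neg_dom (Inr (C, S, \<phi>))"
proof (induction "card {s\<in>D. Pos s \<notin> S}" arbitrary: S \<phi> rule: less_induct)
  case less
  define N where "N = card {s\<in>D. Pos s \<notin> S}"
  have P: "tr_pos_tr_neg_dom (Inl (C, R, Shape s))"
    if s: "s \<in> D" and R: "card {s\<in>D. Pos s \<notin> R} = N" for s R
  proof (rule tr_pos_tr_neg.domintros(8))
    assume "Pos s \<notin> R"
    then have "{t\<in>D. Pos t \<notin> insert (Pos s) R} \<subset> {t\<in>D. Pos t \<notin> R}"
      using s by blast
    then have "card {t\<in>D. Pos t \<notin> insert (Pos s) R} < N"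
      unfolding R[symmetric] by (rule psubset_card_mono[rotated]) (simp add: fin)
    then show "tr_pos_tr_neg_dom (Inl (C, insert (Pos s) R, body C s))"
      using less(1)[of "insert (Pos s) R" "body C s"] cl[OF s] unfolding N_def by blast
  qed
  have Q: "tr_pos_tr_neg_dom (Inr (C, R, \<psi>))"
    if "expr_shapes \<psi> \<subseteq> D" and "card {s\<in>D. Pos s \<notin> R} = N" for \<psi> R
    using that
  proof (induction "card {s\<in>D. Bar s \<notin> R}" arbitrary: R \<psi> rule: less_induct)
    case (less R \<psi>)
    note IH = less(1) and N = less(3)
    show ?case
      using less(2)
    proof (induction \<psi>)
      case (Shape s)
      then have s: "s \<in> D" by simp
      show ?case
      proof (rule tr_pos_tr_neg.domintros(16))
        assume "Bar s \<notin> R"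
        then have "{t\<in>D. Bar t \<notin> insert (Bar s) R} \<subset> {t\<in>D. Bar t \<notin> R}"
          using s by blast
        then have "card {t\<in>D. Bar t \<notin> insert (Bar s) R} < card {t\<in>D. Bar t \<notin> R}"
          by (rule psubset_card_mono[rotated]) (simp add: fin)
        moreover have "card {t\<in>D. Pos t \<notin> insert (Bar s) R} = N"
          using N by simp
        ultimately show "tr_pos_tr_neg_dom (Inr (C, insert (Bar s) R, body C s))"
          using IH cl[OF s] by blast
      qed
    next
      case (Concept A)
      show ?case by (rule tr_pos_tr_neg.domintros(13))
    next
      case (Nominal a)
      show ?case by (rule tr_pos_tr_neg.domintros(14))
    next
      case (NegShape s)
      have "Pos t \<notin> pos_part R \<longleftrightarrow> Pos t \<notin> R" for t
        by (auto simp: pos_part_def)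
      then have "card {t\<in>D. Pos t \<notin> pos_part R} = N"
        using N by simp
      then have "tr_pos_tr_neg_dom (Inl (C, pos_part R, Shape s))"
        using NegShape P by simp
      then show ?case by (rule tr_pos_tr_neg.domintros(15))
    next
      case (And \<phi> \<psi>)
      then show ?case by (intro tr_pos_tr_neg.domintros(9)) simp_all
    next
      case (Or \<phi> \<psi>)
      then show ?case by (intro tr_pos_tr_neg.domintros(10)) simp_all
    next
      case (Exists r \<phi>)
      then show ?case by (intro tr_pos_tr_neg.domintros(11)) simp
    next
      case (Forall r \<phi>)
      then show ?case by (intro tr_pos_tr_neg.domintros(12)) simp
    qed
  qed
  have "tr_pos_tr_neg_dom (Inl (C, S, \<phi>))"
    using less.prems
  proof (induction \<phi>)
    case (Shape s)
    then show ?case using P[of s S] N_def by simp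
  next
    case (Concept A)
    show ?case by (rule tr_pos_tr_neg.domintros(5))
  next
    case (Nominal a)
    show ?case by (rule tr_pos_tr_neg.domintros(6))
  next
    case (NegShape s)
    then have "tr_pos_tr_neg_dom (Inr (C, S, Shape s))"
      using Q[of "Shape s" S] N_def by simp
    then show ?case by (rule tr_pos_tr_neg.domintros(7))
  next
    case (And \<phi> \<psi>)
    then show ?case by (intro tr_pos_tr_neg.domintros(1)) simp_all
  next
    case (Or \<phi> \<psi>)
    then show ?case by (intro tr_pos_tr_neg.domintros(2)) simp_all
  next
    case (Exists r \<phi>)
    then show ?case by (intro tr_pos_tr_neg.domintros(3)) simp
  next
    case (Forall r \<phi>)
    then show ?case by (intro tr_pos_tr_neg.domintros(4)) simp
  qed
  moreover have "tr_pos_tr_neg_dom (Inr (C, S, \<phi>))"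
    using Q[of \<phi> S] less.prems N_def by simp
  ultimately show ?case ..
qed

lemma tr_dom:
  assumes nf: "normal_form C" and closed: "shape_names C \<subseteq> heads C" and s: "s \<in> heads C"
    and fin: "finite ((dependency C)\<^sup>* `` {s})"
  shows "tr_pos_tr_neg_dom (Inl (C, S, Shape s))"
proof -
  let ?D = "(dependency C)\<^sup>* `` {s}"
  have "t \<in> heads C" if "(s, t) \<in> (dependency C)\<^sup>*" for t
    using that s closed
    by (induction rule: rtrancl_induct) (auto simp: dependency_def shape_names_def)
  then have "expr_shapes (body C t) \<subseteq> ?D" if "t \<in> ?D" for t
    using that body_shapes_dependency[OF nf, of t] by (auto intro: rtrancl_into_rtrancl)
  then show ?thesis
    using tr_dom_closed[OF fin, of C "Shape s" S] by auto
qed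

lemma finite_dependencies:
  assumes "finite C"
  shows "finite ((dependency C)\<^sup>* `` {s})"
proof -
  have fin: "finite (expr_shapes \<phi>)" for \<phi>
    by (induction \<phi>) auto
  have "t \<in> insert s (\<Union>(s', \<phi>)\<in>C. expr_shapes \<phi>)" if "(s, t) \<in> (dependency C)\<^sup>*" for t
    using that by (induction rule: rtrancl_induct) (auto simp: dependency_def)
  then have "(dependency C)\<^sup>* `` {s} \<subseteq> insert s (\<Union>(s', \<phi>)\<in>C. expr_shapes \<phi>)"
    by blast
  moreover have "finite (insert s (\<Union>(s', \<phi>)\<in>C. expr_shapes \<phi>))"
    using assms fin by auto
  ultimately show ?thesis
    by (rule finite_subset)
qed

lemma free_vars_tr:
  "tr_pos_tr_neg_dom (Inl (C, S, \<phi>)) \<Longrightarrow> free_vars (tr_pos C S \<phi>) \<subseteq> S"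
  "tr_pos_tr_neg_dom (Inr (C', S', \<psi>)) \<Longrightarrow> free_vars (tr_neg C' S' \<psi>) \<subseteq> S'"
  by (induction C S \<phi> and C' S' \<psi> rule: tr_pos_tr_neg.pinduct)
    (auto simp: tr_pos.psimps tr_neg.psimps pos_part_def)

end

theory Submission
  imports Defs
begin

text \<open>
  Separating the two kinds of literals, the well-founded model is the solution of a system of
  equations: its positive part is the least \<open>P\<close> with \<open>P = T P (N P)\<close>, where \<open>N P\<close> is the greatest
  solution of \<open>N = F P N\<close> (the atoms that are false given \<open>P\<close>). The translation solves this system
  one variable at a time by Bekic's principle: \<open>S\<close> records the variables whose values are already
  fixed, and passing from a negative to a positive literal leaves the inner, greatest fixed point,
  so that the barred variables are forgotten.
\<close>

section \<open>Solving systems of equations variable by variable\<close>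

text \<open>The indices in \<open>A\<close> are parameters. Keeping them in the system with the
  constant right-hand side \<open>v\<close> lets one index type serve every
  \<open>A\<close>.\<close>

definition lfp_par :: "'i set \<Rightarrow> ('i \<Rightarrow> 'a) \<Rightarrow> (('i \<Rightarrow> 'a) \<Rightarrow> 'i \<Rightarrow> 'a) \<Rightarrow> 'i \<Rightarrow> 'a::complete_lattice"
  where "lfp_par A v H = lfp (\<lambda>p i. if i \<in> A then v i else H p i)"

definition gfp_par :: "'i set \<Rightarrow> ('i \<Rightarrow> 'a) \<Rightarrow> (('i \<Rightarrow> 'a) \<Rightarrow> 'i \<Rightarrow> 'a) \<Rightarrow> 'i \<Rightarrow> 'a::complete_lattice"
  where "gfp_par A v H = gfp (\<lambda>p i. if i \<in> A then v i else H p i)"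

lemma mono_par:
  fixes H :: "('i \<Rightarrow> 'a::complete_lattice) \<Rightarrow> 'i \<Rightarrow> 'a"
  assumes "mono H"
  shows "mono (\<lambda>p i. if i \<in> A then v i else H p i)"
  using assms by (auto simp: mono_def le_fun_def)

lemma lfp_par_unfold:
  assumes "mono H"
  shows "lfp_par A v H i = (if i \<in> A then v i else H (lfp_par A v H) i)"
  using fun_cong[OF lfp_unfold[OF mono_par[OF assms, of A v]], of i]
  unfolding lfp_par_def[symmetric] .

lemma gfp_par_unfold:
  assumes "mono H"
  shows "gfp_par A v H i = (if i \<in> A then v i else H (gfp_par A v H) i)"
  using fun_cong[OF gfp_unfold[OF mono_par[OF assms, of A v]], of i]
  unfolding gfp_par_def[symmetric] .

lemma lfp_par_lowerbound:
  assumes "\<And>i. (if i \<in> A then v i else H p i) \<le> p i"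
  shows "lfp_par A v H \<le> p"
  unfolding lfp_par_def by (rule lfp_lowerbound) (use assms in \<open>simp add: le_fun_def\<close>)

lemma gfp_par_upperbound:
  assumes "\<And>i. p i \<le> (if i \<in> A then v i else H p i)"
  shows "p \<le> gfp_par A v H"
  unfolding gfp_par_def by (rule gfp_upperbound) (use assms in \<open>simp add: le_fun_def\<close>)

text \<open>Bekic's principle for one variable. The solution \<open>?p\<close> also solves the
  system with \<open>i\<close> frozen at \<open>?p i\<close>, so \<open>?p i\<close> is a candidate;
  conversely, for any candidate \<open>u\<close>, the solution with \<open>i\<close> frozen at
  \<open>u\<close> is a pre-fixed point of the system with \<open>i\<close> free. The bound
  \<open>d\<close> stands for the restriction to node sets in the semantics of
  \<open>Mu\<close>.\<close>

lemma lfp_par_insert: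
  fixes H :: "('i \<Rightarrow> 'a::complete_lattice) \<Rightarrow> 'i \<Rightarrow> 'a"
  assumes H: "mono H" and i: "i \<notin> A" and d: "lfp_par A v H i \<le> d"
  shows "Inf {u. u \<le> d \<and> H (lfp_par (insert i A) (v(i := u)) H) i \<le> u} = lfp_par A v H i"
    (is "Inf ?U = ?p i")
proof (rule antisym)
  have p: "?p j = (if j \<in> A then v j else H ?p j)" for j
    by (rule lfp_par_unfold[OF H])
  have "lfp_par (insert i A) (v(i := ?p i)) H \<le> ?p"
  proof (rule lfp_par_lowerbound)
    fix j
    show "(if j \<in> insert i A then (v(i := ?p i)) j else H ?p j) \<le> ?p j"
      using p[of j] by (cases "j = i") auto
  qed
  then have "H (lfp_par (insert i A) (v(i := ?p i)) H) i \<le> H ?p i"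
    using H by (auto simp: mono_def le_fun_def)
  also have "H ?p i = ?p i"
    using i p[of i] by simp
  finally show "Inf ?U \<le> ?p i"
    using d by (intro Inf_lower) simp
next
  show "?p i \<le> Inf ?U"
  proof (rule Inf_greatest)
    fix u assume u: "u \<in> ?U"
    let ?q = "lfp_par (insert i A) (v(i := u)) H"
    have q: "?q j = (if j \<in> insert i A then (v(i := u)) j else H ?q j)" for j
      by (rule lfp_par_unfold[OF H])
    have "?p \<le> ?q"
    proof (rule lfp_par_lowerbound)
      fix j
      show "(if j \<in> A then v j else H ?q j) \<le> ?q j"
        using u i q[of j] by (cases "j = i") auto
    qed
    then have "?p i \<le> ?q i" by (simp add: le_fun_def)
    also have "?q i = u" using q[of i] by simp
    finally show "?p i \<le> u" .
  qed
qed

lemma gfp_par_insert: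
  fixes H :: "('i \<Rightarrow> 'a::complete_lattice) \<Rightarrow> 'i \<Rightarrow> 'a"
  assumes H: "mono H" and i: "i \<notin> A" and d: "gfp_par A v H i \<le> d"
  shows "Sup {u. u \<le> d \<and> u \<le> H (gfp_par (insert i A) (v(i := u)) H) i} = gfp_par A v H i"
    (is "Sup ?U = ?p i")
proof (rule antisym)
  have p: "?p j = (if j \<in> A then v j else H ?p j)" for j
    by (rule gfp_par_unfold[OF H])
  have "?p \<le> gfp_par (insert i A) (v(i := ?p i)) H"
  proof (rule gfp_par_upperbound)
    fix j
    show "?p j \<le> (if j \<in> insert i A then (v(i := ?p i)) j else H ?p j)"
      using p[of j] by (cases "j = i") auto
  qed
  then have "H ?p i \<le> H (gfp_par (insert i A) (v(i := ?p i)) H) i"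
    using H by (auto simp: mono_def le_fun_def)
  then show "?p i \<le> Sup ?U"
    using d i p[of i] by (intro Sup_upper) simp
next
  show "Sup ?U \<le> ?p i"
  proof (rule Sup_least)
    fix u assume u: "u \<in> ?U"
    let ?q = "gfp_par (insert i A) (v(i := u)) H"
    have q: "?q j = (if j \<in> insert i A then (v(i := u)) j else H ?q j)" for j
      by (rule gfp_par_unfold[OF H])
    have "?q \<le> ?p"
    proof (rule gfp_par_upperbound)
      fix j
      show "?q j \<le> (if j \<in> A then v j else H ?q j)"
        using u i q[of j] by (cases "j = i") auto
    qed
    then have "?q i \<le> ?p i" by (simp add: le_fun_def)
    moreover have "?q i = u" using q[of i] by simp
    ultimately show "u \<le> ?p i" by simp
  qed
qed

section \<open>The system of equations for the well-founded semantics\<close>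

type_synonym interp = "shape_name \<Rightarrow> individual set"

definition lits :: "interp \<Rightarrow> interp \<Rightarrow> literal set" where
  "lits P N = {Lit (s, a) | s a. a \<in> P s} \<union> {NegLit (s, a) | s a. a \<in> N s}"

text \<open>The cut to \<open>nodes G\<close>, absent from \<open>T_op\<close>, bounds every value
  unconditionally. It loses nothing when the graph is compatible and \<open>P\<close>,
  \<open>N\<close> lie within the nodes.\<close>

definition T_sys :: "data_graph \<Rightarrow> shape_constraint set \<Rightarrow> interp \<Rightarrow> interp \<Rightarrow> interp" where
  "T_sys G C P N s = (if s \<in> heads C then nodes G \<inter> lower G (lits P N) (body C s) else {})"

definition F_sys :: "data_graph \<Rightarrow> shape_constraint set \<Rightarrow> interp \<Rightarrow> interp \<Rightarrow> interp" where
  "F_sys G C P N s = (if s \<in> heads C then nodes G - upper G (lits P N) (body C s) else {})"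

text \<open>The greatest unfounded set relative to the positive literals \<open>P\<close> alone,
  with no negative literal given beforehand.\<close>

definition false_given :: "data_graph \<Rightarrow> shape_constraint set \<Rightarrow> interp \<Rightarrow> interp" where
  "false_given G C P = gfp (F_sys G C P)"

definition T_step :: "data_graph \<Rightarrow> shape_constraint set \<Rightarrow> interp \<Rightarrow> interp" where
  "T_step G C P = T_sys G C P (false_given G C P)"

lemma Lit_in_lits [simp]: "Lit (s, a) \<in> lits P N \<longleftrightarrow> a \<in> P s"
  and NegLit_in_lits [simp]: "NegLit (s, a) \<in> lits P N \<longleftrightarrow> a \<in> N s"
  by (auto simp: lits_def)

lemma lits_mono: "P \<le> P' \<Longrightarrow> N \<le> N' \<Longrightarrow> lits P N \<subseteq> lits P' N'"
  unfolding lits_def le_fun_def by blast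

lemma T_sys_mono: "P \<le> P' \<Longrightarrow> N \<le> N' \<Longrightarrow> T_sys G C P N \<le> T_sys G C P' N'"
  by (rule le_funI) (simp add: T_sys_def le_infI2 lower_mono lits_mono)

lemma F_sys_mono: "P \<le> P' \<Longrightarrow> N \<le> N' \<Longrightarrow> F_sys G C P N \<le> F_sys G C P' N'"
  by (rule le_funI) (simp add: F_sys_def Diff_mono upper_antimono lits_mono)

lemma mono_F_sys: "mono (F_sys G C P)"
  by (rule monoI) (rule F_sys_mono[OF order_refl])

lemma false_given_mono: "P \<le> P' \<Longrightarrow> false_given G C P \<le> false_given G C P'"
  unfolding false_given_def by (rule gfp_mono) (rule F_sys_mono[OF _ order_refl])

lemma mono_T_step: "mono (T_step G C)"
  unfolding T_step_def by (intro monoI T_sys_mono false_given_mono)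

lemma F_sys_false_given: "F_sys G C P (false_given G C P) = false_given G C P"
  unfolding false_given_def by (rule gfp_fixpoint[OF mono_F_sys])

lemma T_sys_nodes: "T_sys G C P N s \<subseteq> nodes G"
  and F_sys_nodes: "F_sys G C P N s \<subseteq> nodes G"
  by (simp_all add: T_sys_def F_sys_def)

lemma concept_ext_nodes: "concept_ext G A \<subseteq> nodes G"
  by (force simp: concept_ext_def nodes_def)

lemma role_ext_nodes: "(a, b) \<in> role_ext G r \<Longrightarrow> b \<in> nodes G"
  by (cases r) (force simp: nodes_def)+

lemma lower_nodes:
  assumes "\<And>s. P s \<subseteq> nodes G" "\<And>s. N s \<subseteq> nodes G"
  shows "expr_individuals \<phi> \<subseteq> nodes G \<Longrightarrow> lower G (lits P N) \<phi> \<subseteq> nodes G"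
  by (induction \<phi>) (use assms concept_ext_nodes in auto)

lemma body_eq:
  assumes "normal_form C" "(s, \<phi>) \<in> C"
  shows "body C s = \<phi>"
  unfolding body_def using assms by (auto simp: normal_form_def)

lemma in_C_iff:
  assumes "normal_form C"
  shows "(s, \<phi>) \<in> C \<longleftrightarrow> s \<in> heads C \<and> body C s = \<phi>"
  using body_eq[OF assms] by (force simp: heads_def)

lemma body_individuals_nodes:
  assumes "normal_form C" "compatible G C" "s \<in> heads C"
  shows "expr_individuals (body C s) \<subseteq> nodes G"
  using assms in_C_iff[OF assms(1), of s] by (force simp: compatible_def constraint_individuals_def)

lemma body_shapes_heads:
  assumes "normal_form C" "shape_names C \<subseteq> heads C" "s \<in> heads C"
  shows "expr_shapes (body C s) \<subseteq> heads C"
  using assms in_C_iff[OF assms(1), of s] by (force simp: shape_names_def)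

text \<open>Adding the negations of \<open>U\<close> only changes the negative part from
  \<open>N\<close> to \<open>sup N U\<close>; the restriction to heads and nodes is built into
  \<open>F_sys\<close>. Unfoundedness thereby becomes a post-fixed point condition relative to
  \<open>N\<close>.\<close>

lemma unfounded_iff:
  "unfounded G C (lits P N) {(s, a). a \<in> U s} \<longleftrightarrow> U \<le> F_sys G C P (sup N U)"
proof -
  have "lits P N \<union> NegLit ` {(s, a). a \<in> U s} = lits P (sup N U)"
    by (auto simp: lits_def)
  then show ?thesis
    by (auto simp: unfounded_def F_sys_def le_fun_def split: if_splits)
qed

text \<open>\<open>W_op\<close> accumulates negative literals, whereas \<open>T_step\<close>
  recomputes them from \<open>P\<close> at each step. Both directions are leastness arguments: the
  nested solution is closed under \<open>W_op\<close>, and the positive part of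
  \<open>WF G C\<close> is closed under \<open>T_step G C\<close>.\<close>

lemma WF_positive:
  assumes nf: "normal_form C" and comp: "compatible G C"
  shows "Lit (s, a) \<in> WF G C \<longleftrightarrow> a \<in> lfp (T_step G C) s"
proof
  define P where "P = lfp (T_step G C)"
  define N where "N = false_given G C P"
  have P: "T_sys G C P N = P"
    unfolding N_def T_step_def[symmetric] P_def by (rule lfp_fixpoint[OF mono_T_step])
  have N: "F_sys G C P N = N"
    unfolding N_def by (rule F_sys_false_given)
  have "T_op G C (lits P N) \<subseteq> lits P N"
  proof
    fix l assume "l \<in> T_op G C (lits P N)"
    then obtain s a where l: "l = Lit (s, a)" and s: "s \<in> heads C"
      and a: "a \<in> lower G (lits P N) (body C s)"
      by (auto simp: T_op_def in_C_iff[OF nf])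
    have "P t \<subseteq> nodes G" "N t \<subseteq> nodes G" for t
      using T_sys_nodes[of G C P N t] F_sys_nodes[of G C P N t] P N by simp_all
    \<comment> \<open>Compatibility keeps nominals within the graph, so the cut in
      \<open>T_sys\<close> does not remove \<open>a\<close>.\<close>
    then have "a \<in> nodes G"
      using a lower_nodes[OF _ _ body_individuals_nodes[OF nf comp s]] by blast
    with a s have "a \<in> T_sys G C P N s"
      by (simp add: T_sys_def)
    then show "l \<in> lits P N"
      by (simp add: P l)
  qed
  moreover have "NegLit ` greatest_unfounded G C (lits P N) \<subseteq> lits P N"
  proof -
    define U where "U s = {a. (s, a) \<in> greatest_unfounded G C (lits P N)}" for s
    have U: "greatest_unfounded G C (lits P N) = {(s, a). a \<in> U s}"
      by (auto simp: U_def)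
    have "U \<le> F_sys G C P (sup N U)"
      using unfounded_greatest_unfounded[of G C "lits P N"] unfolding U unfounded_iff .
    moreover have "N \<le> F_sys G C P (sup N U)"
      using F_sys_mono[of P P N "sup N U" G C] N by simp
    \<comment> \<open>Coinduction: \<open>N\<close> together with an unfounded set is again a
      post-fixed point, so the greatest one, \<open>N\<close>, absorbs \<open>U\<close>.\<close>
    ultimately have "sup N U \<le> gfp (F_sys G C P)"
      by (intro gfp_upperbound sup_least)
    then have "U \<le> N"
      by (simp add: N_def false_given_def)
    then have "x \<in> N t" if "x \<in> U t" for t x
      using that by (blast dest: le_funD)
    then show ?thesis
      unfolding U by auto
  qed
  ultimately have "WF G C \<subseteq> lits P N"
    unfolding WF_def by (intro lfp_lowerbound) (simp add: W_op_def)
  then show "a \<in> P s" if "Lit (s, a) \<in> WF G C"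
    using that by auto
next
  define P where "P s = {a. Lit (s, a) \<in> WF G C}" for s
  define N where "N s = {a. NegLit (s, a) \<in> WF G C}" for s
  have lits: "lits P N = WF G C"
  proof (rule set_eqI)
    show "l \<in> lits P N \<longleftrightarrow> l \<in> WF G C" for l
      by (cases l) (auto simp: P_def N_def)
  qed
  have W: "W_op G C (lits P N) = lits P N"
    unfolding lits WF_def by (rule lfp_fixpoint[OF mono_W_op])
  let ?U = "false_given G C P"
  \<comment> \<open>By monotonicity, what is unfounded from \<open>P\<close> alone stays unfounded
    once \<open>N\<close> is added.\<close>
  have "?U \<le> F_sys G C P (sup N ?U)"
    using F_sys_mono[of P P ?U "sup N ?U" G C] by (simp add: F_sys_false_given)
  then have "{(s, a). a \<in> ?U s} \<subseteq> greatest_unfounded G C (lits P N)"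
    unfolding unfounded_iff[symmetric] greatest_unfounded_def by blast
  then have "NegLit ` {(s, a). a \<in> ?U s} \<subseteq> lits P N"
    using W unfolding W_op_def by blast
  then have "NegLit (s, a) \<in> lits P N" if "a \<in> ?U s" for s a
    using that by blast
  then have "?U \<le> N"
    by (simp add: le_fun_def subset_iff)
  then have "T_step G C P \<le> T_sys G C P N"
    unfolding T_step_def by (intro T_sys_mono order_refl)
  also have "T_sys G C P N \<le> P"
  proof -
    have "T_op G C (lits P N) \<subseteq> lits P N"
      using W unfolding W_op_def by blast
    then have "Lit (s, a) \<in> lits P N"
      if "s \<in> heads C" "a \<in> lower G (lits P N) (body C s)" for s a
      using that unfolding T_op_def in_C_iff[OF nf] by blast
    then show ?thesis
      by (auto simp: le_fun_def T_sys_def)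
  qed
  finally have "lfp (T_step G C) \<le> P"
    by (rule lfp_lowerbound)
  then show "a \<in> lfp (T_step G C) s \<Longrightarrow> Lit (s, a) \<in> WF G C"
    by (auto simp: le_fun_def P_def)
qed

section \<open>Correctness of the translation\<close>

text \<open>Barred symbols have no influence here, since \<open>T_step\<close> solves for all
  negative values afresh.\<close>

definition P_of :: "data_graph \<Rightarrow> shape_constraint set \<Rightarrow> symbol set \<Rightarrow> (symbol \<Rightarrow> individual set) \<Rightarrow> interp"
  where "P_of G C S V = lfp_par {s. Pos s \<in> S} (\<lambda>s. V (Pos s)) (T_step G C)"

definition N_of :: "data_graph \<Rightarrow> shape_constraint set \<Rightarrow> symbol set \<Rightarrow> (symbol \<Rightarrow> individual set) \<Rightarrow> interp"
  where "N_of G C S V =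
    gfp_par {s. Bar s \<in> S} (\<lambda>s. V (Bar s)) (F_sys G C (P_of G C S V))"

abbreviation lits_of ::
    "data_graph \<Rightarrow> shape_constraint set \<Rightarrow> symbol set \<Rightarrow> (symbol \<Rightarrow> individual set) \<Rightarrow> literal set"
  where "lits_of G C S V \<equiv> lits (P_of G C S V) (N_of G C S V)"

lemma P_of_unfold:
  "P_of G C S V s = (if Pos s \<in> S then V (Pos s) else T_step G C (P_of G C S V) s)"
  unfolding P_of_def by (subst lfp_par_unfold[OF mono_T_step]) simp

lemma N_of_unfold:
  "N_of G C S V s = (if Bar s \<in> S then V (Bar s) else F_sys G C (P_of G C S V) (N_of G C S V) s)"
  unfolding N_of_def by (subst gfp_par_unfold[OF mono_F_sys]) simp

text \<open>With no barred symbol frozen, one application of \<open>T_sys\<close> to the current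
  values is a \<open>T_step\<close>; the \<open>Mu\<close> case of \<open>sem_tr\<close> needs
  this.\<close>

lemma N_of_Pos: "S \<subseteq> range Pos \<Longrightarrow> N_of G C S V = false_given G C (P_of G C S V)"
proof -
  assume "S \<subseteq> range Pos"
  then have "Bar s \<notin> S" for s by auto
  then show ?thesis by (simp add: N_of_def gfp_par_def false_given_def)
qed

lemma P_of_nodes: "(\<And>X. V X \<subseteq> nodes G) \<Longrightarrow> P_of G C S V s \<subseteq> nodes G"
  using T_sys_nodes by (subst P_of_unfold) (simp add: T_step_def)

lemma N_of_nodes: "(\<And>X. V X \<subseteq> nodes G) \<Longrightarrow> N_of G C S V s \<subseteq> nodes G"
  using F_sys_nodes by (subst N_of_unfold) simp

text \<open>The reason why the translation may drop the barred symbols when it returns from a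
  negative to a positive literal.\<close>

lemma P_of_pos_part: "P_of G C (pos_part S) V = P_of G C S V"
proof -
  have "Pos s \<in> pos_part S \<longleftrightarrow> Pos s \<in> S" for s
    by (auto simp: pos_part_def)
  then show ?thesis
    by (simp add: P_of_def)
qed

text \<open>\<open>lfp_par_insert\<close> in the shape of the semantics of \<open>Mu\<close>, with
  \<open>nodes G\<close> as the bound \<open>d\<close>.\<close>

lemma P_of_insert:
  assumes "Pos s \<notin> S" "\<And>X. V X \<subseteq> nodes G"
  shows "\<Inter>{U. U \<subseteq> nodes G \<and> T_step G C (P_of G C (insert (Pos s) S) (V(Pos s := U))) s \<subseteq> U} =
    P_of G C S V s"
proof -
  have "P_of G C (insert (Pos s) S) (V(Pos s := U)) =
    lfp_par (insert s {s. Pos s \<in> S}) ((\<lambda>s. V (Pos s))(s := U)) (T_step G C)" for U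
    unfolding P_of_def by (intro arg_cong2[where f = "\<lambda>A v. lfp_par A v (T_step G C)"]) auto
  then show ?thesis
    using lfp_par_insert[OF mono_T_step, where i = s and A = "{s. Pos s \<in> S}"
        and v = "\<lambda>s. V (Pos s)" and d = "nodes G"]
      assms(1) P_of_nodes[of V G, OF assms(2)]
    by (simp add: P_of_def)
qed

lemma N_of_insert:
  assumes "Bar s \<notin> S" "\<And>X. V X \<subseteq> nodes G"
  shows "\<Union>{U. U \<subseteq> nodes G \<and>
      U \<subseteq> F_sys G C (P_of G C S V) (N_of G C (insert (Bar s) S) (V(Bar s := U))) s} =
    N_of G C S V s"
proof -
  have P: "P_of G C (insert (Bar s) S) (V(Bar s := U)) = P_of G C S V" for U
    by (simp add: P_of_def)
  have "N_of G C (insert (Bar s) S) (V(Bar s := U)) =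
    gfp_par (insert s {s. Bar s \<in> S}) ((\<lambda>s. V (Bar s))(s := U)) (F_sys G C (P_of G C S V))" for U
    unfolding N_of_def P
    by (intro arg_cong2[where f = "\<lambda>A v. gfp_par A v (F_sys G C (P_of G C S V))"]) auto
  then show ?thesis
    using gfp_par_insert[OF mono_F_sys, where i = s and A = "{s. Bar s \<in> S}"
        and v = "\<lambda>s. V (Bar s)" and d = "nodes G"]
      assms(1) N_of_nodes[of V G, OF assms(2)]
    by (simp add: N_of_def)
qed

text \<open>Induction on the computation, since a shape name unfolds into its body. Symbols in
  \<open>S\<close> take their values from \<open>V\<close>, the others their solutions given these.
  Only the positive half demands that \<open>S\<close> be free of barred symbols;
  \<open>pos_part\<close> restores this on return from the negative half.\<close>

lemma sem_tr:
  "tr_pos_tr_neg_dom (Inl (C, S, \<phi>)) \<Longrightarrow>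
    normal_form C \<Longrightarrow> shape_names C \<subseteq> heads C \<Longrightarrow> compatible G C \<Longrightarrow>
    expr_shapes \<phi> \<subseteq> heads C \<Longrightarrow> S \<subseteq> range Pos \<Longrightarrow> (\<And>X. V X \<subseteq> nodes G) \<Longrightarrow>
    sem G (tr_pos C S \<phi>) V = lower G (lits_of G C S V) \<phi>"
  "tr_pos_tr_neg_dom (Inr (C', S', \<psi>)) \<Longrightarrow>
    normal_form C' \<Longrightarrow> shape_names C' \<subseteq> heads C' \<Longrightarrow> compatible G C' \<Longrightarrow>
    expr_shapes \<psi> \<subseteq> heads C' \<Longrightarrow> (\<And>X. V X \<subseteq> nodes G) \<Longrightarrow>
    sem G (tr_neg C' S' \<psi>) V = nodes G - upper G (lits_of G C' S' V) \<psi>"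
proof (induction C S \<phi> and C' S' \<psi> arbitrary: V and V rule: tr_pos_tr_neg.pinduct)
  case (7 C S s)
  \<comment> \<open>The negative half yields a double complement within the nodes, which gives back
    the value only if it lies within them.\<close>
  have "N_of G C S V s \<subseteq> nodes G"
    using 7 by (intro N_of_nodes)
  with 7 show ?case by (auto simp: tr_pos.psimps)
next
  case (8 C S s)
  show ?case
  proof (cases "Pos s \<in> S")
    case True
    then show ?thesis
      using 8(1) by (simp add: tr_pos.psimps P_of_unfold[of G C S V s])
  next
    case False
    note prems = 8(3-8)
    have s: "s \<in> heads C" using prems(4) by simp
    have "sem G (tr_pos C (insert (Pos s) S) (body C s)) (V(Pos s := U)) =
      T_step G C (P_of G C (insert (Pos s) S) (V(Pos s := U))) s" if U: "U \<subseteq> nodes G" for U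
    proof -
      let ?S = "S \<union> {Pos s}" and ?V = "V(Pos s := U)"
      have V: "?V X \<subseteq> nodes G" for X
        using prems(6) U by simp
      have "sem G (tr_pos C ?S (body C s)) ?V = lower G (lits_of G C ?S ?V) (body C s)"
        by (rule 8(2)[OF False prems(1-3) body_shapes_heads[OF prems(1,2) s] _ V])
          (use prems(5) in simp)
      also have "\<dots> \<subseteq> nodes G"
        by (intro lower_nodes P_of_nodes N_of_nodes V body_individuals_nodes prems s)
      ultimately show ?thesis
        using prems(5) s by (simp add: T_step_def T_sys_def N_of_Pos Int_absorb1)
    qed
    \<comment> \<open>The equation for the body holds only for \<open>U\<close> within the nodes;
      \<open>conj_cong\<close> makes that conjunct available when rewriting.\<close>
    then show ?thesis
      using 8(1) False P_of_insert[OF False prems(6), of C]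
      by (simp add: tr_pos.psimps cong: conj_cong)
  qed
next
  case (15 C S s)
  have "P_of G C S V s \<subseteq> nodes G"
    using 15 by (intro P_of_nodes)
  moreover have "pos_part S \<subseteq> range Pos"
    unfolding pos_part_def by (metis DiffE rangeI subsetI symbol.exhaust)
  ultimately show ?case
    using 15 by (auto simp: tr_neg.psimps P_of_pos_part)
next
  case (16 C S s)
  have N: "nodes G - {a \<in> nodes G. a \<notin> N_of G C S V s} = N_of G C S V s"
    using 16(7) N_of_nodes[of V G] by blast
  show ?case
  proof (cases "Bar s \<in> S")
    case True
    then show ?thesis
      using 16(1) N by (simp add: tr_neg.psimps N_of_unfold[of G C S V s])
  next
    case False
    note prems = 16(3-7)
    have s: "s \<in> heads C" using prems(4) by simp
    have "sem G (tr_neg C (insert (Bar s) S) (body C s)) (V(Bar s := U)) =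
      F_sys G C (P_of G C S V) (N_of G C (insert (Bar s) S) (V(Bar s := U))) s"
      if U: "U \<subseteq> nodes G" for U
    proof -
      let ?S = "S \<union> {Bar s}" and ?V = "V(Bar s := U)"
      have V: "?V X \<subseteq> nodes G" for X
        using prems(5) U by simp
      have "sem G (tr_neg C ?S (body C s)) ?V = nodes G - upper G (lits_of G C ?S ?V) (body C s)"
        by (rule 16(2)[OF False prems(1-3) body_shapes_heads[OF prems(1,2) s] V])
      moreover have "P_of G C ?S ?V = P_of G C S V"
        by (simp add: P_of_def)
      ultimately show ?thesis
        using s by (simp add: F_sys_def)
    qed
    then show ?thesis
      using 16(1) False N N_of_insert[OF False prems(5), of C]
      by (simp add: tr_neg.psimps cong: conj_cong)
  qed
\<comment> \<open>In the negative modal cases the complement within \<open>nodes G\<close> passes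
  through the quantifier because all successors are nodes.\<close>
qed (use role_ext_nodes in \<open>auto simp: tr_pos.psimps tr_neg.psimps\<close>)

theorem theorem3:
  fixes C :: "shape_constraint set" and s :: shape_name
    and G :: data_graph and c :: individual
  assumes "normal_form C"
    and "shape_names C \<subseteq> heads C"
    and "s \<in> heads C"
    and "finite ((dependency C)\<^sup>* `` {s})"
    and "compatible G C"
    and "c \<in> nodes G"
  shows "validates_wf G C s c \<longleftrightarrow> models G c (tr_pos C {} (Shape s))"
proof -
  \<comment> \<open>Nothing is frozen, so the parametrised solution is the plain least fixed
    point.\<close>
  have "P_of G C {} (\<lambda>_. {}) = lfp (T_step G C)"
    by (simp add: P_of_def lfp_par_def)
  then have "models G c (tr_pos C {} (Shape s)) \<longleftrightarrow> c \<in> lfp (T_step G C) s"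
    using sem_tr(1)[OF tr_dom[OF assms(1-4)], where V = "\<lambda>_. {}"] assms by (simp add: models_def)
  then show ?thesis
    by (simp add: validates_wf_def WF_positive[OF assms(1,5)])
qed

end
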